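(* For every positive integer $n$, the number $m_n^{(irr)}$ of irreducible meandric systems on $2n$ bridges, i.e. $m_n^{(irr)} := |\{(\pi,\rho)\in NC(n)^2 \mid M_{\pi,\rho} \text{ is irreducible}\}|$, satisfies $$m_n^{(irr)} = \bigl|\{(\pi,\rho)\in NC(n)^2 \mid \pi\vee\rho = 1_n \text{ and } \pi\wedge\rho = 0_n\}\bigr|,$$ where $\vee$ and $\wedge$ are the join and meet operations of the lattice $NC(n)$, and $0_n$, $1_n$ are its minimal and maximal elements.
   Context: $NC(n)$ is the set of non-crossing partitions of $\{1,\dots,n\}$: partitions for which there are no two distinct blocks $V,W$ and $a<b<c<d$ with $a,c\in V$ and $b,d\in W$. It is partially ordered by reverse refinement: $\pi\le\rho$ iff every block of $\pi$ is contained in a block of $\rho$. $(NC(n),\le)$ is a lattice; $0_n$ is the partition into $n$ singletons and $1_n$ is the partition with one block. The meet $\pi\wedge\rho$ has as blocks the non-empty intersections of blocks of $\pi$ and $\rho$; the join $\pi\vee\rho$ is the smallest element of $NC(n)$ which is $\ge\pi$ and $\ge\rho$. For $\pi\in NC(n)$, $P_\pi$ denotes the permutation of $\{1,\dots,n\}$ whose orbits are the blocks of $\pi$ and which performs an increasing cycle on each block: for a block $\{i_1<\dots<i_k\}$, $P_\pi(i_1)=i_2,\dots,P_\pi(i_{k-1})=i_k$, $P_\pi(i_k)=i_1$. For $\pi,\rho\in NC(n)$, the meandric system $M_{\pi,\rho}$ is the permutation of $\{1,\dots,2n\}$ given by $M_{\pi,\rho}(2i-1)=2P_\pi^{-1}(i)$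 and $M_{\pi,\rho}(2i)=2P_\rho(i)-1$ for $1\le i\le n$. It is reducible if there is a proper subinterval $J=\{a,a+1,\dots,b\}\subset\{1,\dots,2n\}$ (with $1\le a\le b\le 2n$ and $b-a<2n-1$) which is invariant under $M_{\pi,\rho}$; it is irreducible if it is not reducible. *)

theory Defs
  imports
    "HOL-Library.Disjoint_Sets"
    "HOL-Combinatorics.Cycles"
    "HOL-Algebra.Lattice"
begin

subsection \<open>Non-crossing partitions\<close>

definition noncrossing :: "nat set set \<Rightarrow> bool" where
  "noncrossing \<pi> \<longleftrightarrow>
     \<not> (\<exists>V\<in>\<pi>. \<exists>W\<in>\<pi>. V \<noteq> W \<and>
          (\<exists>a b c d. a < b \<and> b < c \<and> c < d \<and> a \<in> V \<and> c \<in> V \<and> b \<in> W \<and> d \<in> W))"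

definition NC :: "nat \<Rightarrow> nat set set set" where
  "NC n = {\<pi>. partition_on {1..n} \<pi> \<and> noncrossing \<pi>}"

definition NC_lattice :: "nat \<Rightarrow> nat set set gorder" where
  "NC_lattice n = \<lparr>carrier = NC n, eq = (=), le = refines {1..n}\<rparr>"

definition NC_zero :: "nat \<Rightarrow> nat set set" where
  "NC_zero n = (\<lambda>i. {i}) ` {1..n}"

definition NC_one :: "nat \<Rightarrow> nat set set" where
  "NC_one n = {{1..n}}"


subsection \<open>Meandric systems\<close>

text \<open>
  The permutation \<open>P\<^sub>\<pi>\<close>: it runs increasingly through each block and is extended by the identity
  outside \<open>\<Union>\<pi>\<close>, so that \<open>inv\<close> (the inverse on the whole type) is its inverse permutation.
\<close>

definition block_perm :: "nat set set \<Rightarrow> nat \<Rightarrow> nat" where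
  "block_perm \<pi> i =
     (if i \<in> \<Union>\<pi> then cycle_of_list (sorted_list_of_set (THE V. V \<in> \<pi> \<and> i \<in> V)) i else i)"

text \<open>
  \<open>M\<^bsub>\<pi>,\<rho>\<^esub>\<close>, also extended by the identity: an odd \<open>k\<close> in the range is \<open>2i - 1\<close> with
  \<open>i = (k + 1) div 2\<close>, an even one is \<open>2i\<close> with \<open>i = k div 2\<close>.
\<close>

definition meandric_system :: "nat \<Rightarrow> nat set set \<Rightarrow> nat set set \<Rightarrow> nat \<Rightarrow> nat" where
  "meandric_system n \<pi> \<rho> k =
     (if k \<in> {1..2*n}
      then if odd k then 2 * inv (block_perm \<pi>) ((k + 1) div 2)
           else 2 * block_perm \<rho> (k div 2) - 1
      else k)"

definition meandric_reducible :: "nat \<Rightarrow> nat set set \<Rightarrow> nat set set \<Rightarrow> bool" where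
  "meandric_reducible n \<pi> \<rho> \<longleftrightarrow>
     (\<exists>a b. 1 \<le> a \<and> a \<le> b \<and> b \<le> 2 * n \<and> b - a < 2 * n - 1 \<and>
            meandric_system n \<pi> \<rho> ` {a..b} = {a..b})"

abbreviation meandric_irreducible :: "nat \<Rightarrow> nat set set \<Rightarrow> nat set set \<Rightarrow> bool" where
  "meandric_irreducible n \<pi> \<rho> \<equiv> \<not> meandric_reducible n \<pi> \<rho>"

definition m_irr :: "nat \<Rightarrow> nat" where
  "m_irr n = card {(\<pi>, \<rho>) \<in> NC n \<times> NC n. meandric_irreducible n \<pi> \<rho>}"


subsection \<open>The lattice structure\<close>

lemma finite_NC: "finite (NC n)"
proof -
  have "NC n \<subseteq> Pow (Pow {1..n})"
    by (auto simp: NC_def partition_on_def)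
  then show ?thesis
    by (rule finite_subset) simp
qed

lemma NC_one_in_NC: "n \<ge> 1 \<Longrightarrow> NC_one n \<in> NC n"
  by (auto simp: NC_def NC_one_def noncrossing_def intro: partition_on_space)

lemma NC_zero_in_NC: "NC_zero n \<in> NC n"
  by (auto simp: NC_def NC_zero_def noncrossing_def partition_on_singletons)

lemma refines_NC_one: "n \<ge> 1 \<Longrightarrow> \<pi> \<in> NC n \<Longrightarrow> refines {1..n} \<pi> (NC_one n)"
  unfolding refines_def NC_def NC_one_def partition_on_def by auto

lemma NC_zero_refines:
  assumes "\<pi> \<in> NC n"
  shows "refines {1..n} (NC_zero n) \<pi>"
  unfolding refines_def
proof (intro conjI ballI)
  show part: "partition_on {1..n} \<pi>" using assms by (simp add: NC_def)
  show "partition_on {1..n} (NC_zero n)"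
    unfolding NC_zero_def by (rule partition_on_singletons)
  fix X assume "X \<in> NC_zero n"
  then obtain i where i: "X = {i}" "i \<in> {1..n}" unfolding NC_zero_def by blast
  have "i \<in> \<Union>\<pi>" using i(2) unfolding partition_onD1[OF part] .
  then show "\<exists>Y\<in>\<pi>. X \<subseteq> Y" using i by auto
qed

lemma NC_common_refinement:
  assumes "\<P> \<subseteq> NC n" and "\<P> \<noteq> {}"
  shows "common_refinement \<P> \<in> NC n"
proof -
  have part: "\<And>P. P \<in> \<P> \<Longrightarrow> partition_on {1..n} P"
    using assms by (auto simp: NC_def)
  have cr: "partition_on {1..n} (common_refinement \<P>)"
    using part assms(2) by (intro partition_on_common_refinement) auto
  have "noncrossing (common_refinement \<P>)"
    unfolding noncrossing_def
  proof (intro notI, elim bexE conjE exE)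
    fix V W a b c d
    assume V: "V \<in> common_refinement \<P>" and W: "W \<in> common_refinement \<P>" and "V \<noteq> W"
      and lt: "a < b" "b < c" "c < d" and mem: "a \<in> V" "c \<in> V" "b \<in> W" "d \<in> W"
    have "\<exists>X\<in>P. V \<subseteq> X \<and> W \<subseteq> X" if P: "P \<in> \<P>" for P
    proof -
      obtain X Y where XY: "X \<in> P" "V \<subseteq> X" "Y \<in> P" "W \<subseteq> Y"
        using common_refinement_exists V W P by meson
      have "noncrossing P" using P assms by (auto simp: NC_def)
      then have "X = Y"
        using XY lt mem unfolding noncrossing_def by (meson subsetD)
      then show ?thesis using XY by blast
    qed
    then obtain F where F: "\<And>P. P \<in> \<P> \<Longrightarrow> F P \<in> P \<and> V \<subseteq> F P \<and> W \<subseteq> F P"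
      by metis
    have "a \<in> \<Inter>(F ` \<P>)" using F mem(1) by blast
    then have I: "\<Inter>(F ` \<P>) \<in> common_refinement \<P>"
      using F unfolding common_refinement by (intro DiffI UN_I[of F]) auto
    have VI: "V \<subseteq> \<Inter>(F ` \<P>)" and WI: "W \<subseteq> \<Inter>(F ` \<P>)" using F by auto
    have eq: "X = Y"
      if "X \<in> common_refinement \<P>" "Y \<in> common_refinement \<P>" "x \<in> X" "X \<subseteq> Y" for X Y x
    proof (rule ccontr)
      assume "X \<noteq> Y"
      then have "X \<inter> Y = {}"
        using that(1,2) partition_onD2[OF cr] unfolding disjoint_def by simp
      with that(3,4) show False by blast
    qed
    show False
      using \<open>V \<noteq> W\<close> eq[OF V I mem(1) VI] eq[OF W I mem(3) WI] by simp
  qed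
  with cr show ?thesis by (simp add: NC_def)
qed

lemma common_refinement_pair:
  assumes "partition_on A \<pi>" "partition_on A \<rho>"
  shows "common_refinement {\<pi>, \<rho>} = {V \<inter> W | V W. V \<in> \<pi> \<and> W \<in> \<rho> \<and> V \<inter> W \<noteq> {}}"
    (is "?L = ?R")
proof
  show "?L \<subseteq> ?R" unfolding common_refinement by auto
  show "?R \<subseteq> ?L"
  proof
    fix X assume "X \<in> ?R"
    then obtain V W where VW: "X = V \<inter> W" "V \<in> \<pi>" "W \<in> \<rho>" "V \<inter> W \<noteq> {}" by auto
    define f where "f P = (if P = \<pi> then V else W)" for P
    have "V = W" if "\<pi> = \<rho>"
    proof (rule ccontr)
      assume "V \<noteq> W"
      with VW that assms(2) have "V \<inter> W = {}"
        unfolding partition_on_def disjoint_def by simp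
      with VW show False by simp
    qed
    then have f: "f \<in> (\<Pi> P\<in>{\<pi>, \<rho>}. P)" "\<Inter>(f ` {\<pi>, \<rho>}) = X"
      using VW by (auto simp: f_def)
    then show "X \<in> ?L"
      using VW unfolding common_refinement by (intro DiffI UN_I[OF f(1)]) auto
  qed
qed

lemma partial_order_NC_lattice: "partial_order (NC_lattice n)"
  by (unfold_locales; simp add: NC_lattice_def NC_def; metis refines_refl refines_asym refines_trans)

lemma NC_lattice_greatest_common_refinement:
  assumes "\<pi> \<in> NC n" "\<rho> \<in> NC n"
  shows "greatest (NC_lattice n) (common_refinement {\<pi>, \<rho>}) (Lower (NC_lattice n) {\<pi>, \<rho>})"
proof -
  have part: "\<And>P. P \<in> {\<pi>, \<rho>} \<Longrightarrow> partition_on {1..n} P"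
    using assms by (auto simp: NC_def)
  have "common_refinement {\<pi>, \<rho>} \<in> NC n"
    using assms by (intro NC_common_refinement) auto
  moreover have "\<And>P. P \<in> {\<pi>, \<rho>} \<Longrightarrow> refines {1..n} (common_refinement {\<pi>, \<rho>}) P"
    by (rule refines_common_refinement[OF part])
  moreover have "refines {1..n} \<sigma> (common_refinement {\<pi>, \<rho>})"
    if "\<sigma> \<in> NC n" "refines {1..n} \<sigma> \<pi>" "refines {1..n} \<sigma> \<rho>" for \<sigma>
    using that part by (intro common_refinement_coarsest) (auto simp: NC_def)
  ultimately show ?thesis
    using assms by (auto simp: greatest_def Lower_def NC_lattice_def)
qed

theorem lattice_NC_lattice:
  assumes "n \<ge> 1"
  shows "lattice (NC_lattice n)"
proof -
  interpret partial_order "NC_lattice n" by (rule partial_order_NC_lattice)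
  show ?thesis
  proof unfold_locales
    fix x y assume "x \<in> carrier (NC_lattice n)" "y \<in> carrier (NC_lattice n)"
    then have xy: "x \<in> NC n" "y \<in> NC n" by (simp_all add: NC_lattice_def)
    then show "\<exists>s. greatest (NC_lattice n) s (Lower (NC_lattice n) {x, y})"
      using NC_lattice_greatest_common_refinement by blast
    define U where "U = {\<sigma> \<in> NC n. refines {1..n} x \<sigma> \<and> refines {1..n} y \<sigma>}"
    have U: "Upper (NC_lattice n) {x, y} = U"
      using xy by (auto simp: U_def Upper_def NC_lattice_def)
    have "NC_one n \<in> U"
      using assms xy NC_one_in_NC refines_NC_one by (auto simp: U_def)
    then have ne: "U \<noteq> {}" by auto
    have sub: "U \<subseteq> NC n" by (auto simp: U_def)
    have part: "\<And>P. P \<in> U \<Longrightarrow> partition_on {1..n} P" by (auto simp: U_def NC_def)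
    have "refines {1..n} x (common_refinement U)" "refines {1..n} y (common_refinement U)"
      using part ne xy by (intro common_refinement_coarsest; auto simp: U_def NC_def)+
    then have "common_refinement U \<in> U"
      using NC_common_refinement[OF sub ne] by (simp add: U_def)
    moreover have "\<And>P. P \<in> U \<Longrightarrow> refines {1..n} (common_refinement U) P"
      by (rule refines_common_refinement[OF part])
    ultimately show "\<exists>s. least (NC_lattice n) s (Upper (NC_lattice n) {x, y})"
      unfolding U using sub
      by (intro exI[of _ "common_refinement U"]) (simp add: least_def NC_lattice_def)
  qed
qed

lemma NC_meet_eq:
  assumes "n \<ge> 1" "\<pi> \<in> NC n" "\<rho> \<in> NC n"
  shows "\<pi> \<sqinter>\<^bsub>NC_lattice n\<^esub> \<rho> = {V \<inter> W | V W. V \<in> \<pi> \<and> W \<in> \<rho> \<and> V \<inter> W \<noteq> {}}"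
proof -
  interpret lattice "NC_lattice n" by (rule lattice_NC_lattice[OF assms(1)])
  have "\<pi> \<sqinter>\<^bsub>NC_lattice n\<^esub> \<rho> = common_refinement {\<pi>, \<rho>}"
    unfolding meet_def inf_def
    using NC_lattice_greatest_common_refinement[OF assms(2,3)]
    by (rule someI2) (rule greatest_unique[OF _ NC_lattice_greatest_common_refinement[OF assms(2,3)]])
  then show ?thesis
    using common_refinement_pair[of "{1..n}" \<pi> \<rho>] assms by (simp add: NC_def)
qed

lemma NC_zero_least: "least (NC_lattice n) (NC_zero n) (carrier (NC_lattice n))"
  using NC_zero_in_NC NC_zero_refines by (auto simp: least_def NC_lattice_def)

lemma NC_one_greatest: "n \<ge> 1 \<Longrightarrow> greatest (NC_lattice n) (NC_one n) (carrier (NC_lattice n))"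
  using NC_one_in_NC refines_NC_one by (auto simp: greatest_def NC_lattice_def)


subsection \<open>The permutations\<close>

lemma the_block:
  assumes "partition_on A \<pi>" "V \<in> \<pi>" "i \<in> V"
  shows "(THE V. V \<in> \<pi> \<and> i \<in> V) = V"
  using assms by (intro the_equality) (auto simp: partition_on_def disjoint_def)

lemma block_perm_block:
  assumes "partition_on A \<pi>" "V \<in> \<pi>" "i \<in> V"
  shows "block_perm \<pi> i = cycle_of_list (sorted_list_of_set V) i"
proof -
  have "i \<in> \<Union>\<pi>" using assms by blast
  then show ?thesis by (simp add: block_perm_def the_block[OF assms])
qed

lemma block_perm_image:
  assumes "partition_on A \<pi>" "finite A" "V \<in> \<pi>"
  shows "block_perm \<pi> ` V = V"
proof -
  have "finite V"
    using assms by (metis Union_upper finite_subset partition_onD1)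
  then have "cycle_of_list (sorted_list_of_set V) permutes V"
    using cycle_permutes[of "sorted_list_of_set V"] by simp
  moreover have "block_perm \<pi> ` V = cycle_of_list (sorted_list_of_set V) ` V"
    using block_perm_block[OF assms(1,3)] by (rule image_cong[OF refl])
  ultimately show ?thesis by (simp add: permutes_image)
qed

lemma block_perm_permutes:
  assumes "\<pi> \<in> NC n"
  shows "block_perm \<pi> permutes {1..n}"
proof (rule bij_imp_permutes)
  have part: "partition_on {1..n} \<pi>" using assms by (simp add: NC_def)
  then have U: "\<Union>\<pi> = {1..n}" by (simp add: partition_on_def)
  have "block_perm \<pi> ` (\<Union>\<pi>) = \<Union>\<pi>"
    using block_perm_image[OF part] by (simp add: image_Union)
  then show "bij_betw (block_perm \<pi>) {1..n} {1..n}"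
    unfolding U by (simp add: bij_betw_def eq_card_imp_inj_on)
  show "\<And>i. i \<notin> {1..n} \<Longrightarrow> block_perm \<pi> i = i"
    unfolding block_perm_def U by auto
qed

text \<open>The defining property of \<open>P\<^sub>\<pi>\<close>: it rotates the increasing enumeration of each block.\<close>

lemma map_block_perm:
  assumes "partition_on A \<pi>" "finite A" "V \<in> \<pi>"
  shows "map (block_perm \<pi>) (sorted_list_of_set V) = rotate1 (sorted_list_of_set V)"
proof -
  have "finite V"
    using assms by (metis Union_upper finite_subset partition_onD1)
  then have "map (block_perm \<pi>) (sorted_list_of_set V)
      = map (cycle_of_list (sorted_list_of_set V)) (sorted_list_of_set V)"
    using block_perm_block[OF assms(1,3)] by simp
  also have "\<dots> = rotate1 (sorted_list_of_set V)"
    using cyclic_rotation[of "sorted_list_of_set V" 1] by simp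
  finally show ?thesis .
qed

lemma meandric_system_odd:
  "1 \<le> i \<Longrightarrow> i \<le> n \<Longrightarrow> meandric_system n \<pi> \<rho> (2 * i - 1) = 2 * inv (block_perm \<pi>) i"
  by (auto simp: meandric_system_def)

lemma meandric_system_even:
  "1 \<le> i \<Longrightarrow> i \<le> n \<Longrightarrow> meandric_system n \<pi> \<rho> (2 * i) = 2 * block_perm \<rho> i - 1"
  by (auto simp: meandric_system_def)

lemma meandric_system_permutes:
  assumes "\<pi> \<in> NC n" "\<rho> \<in> NC n"
  shows "meandric_system n \<pi> \<rho> permutes {1..2*n}"
proof (rule bij_imp_permutes)
  let ?M = "meandric_system n \<pi> \<rho>"
  have P: "inv (block_perm \<pi>) permutes {1..n}" and Q: "block_perm \<rho> permutes {1..n}"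
    using assms block_perm_permutes permutes_inv by blast+
  have "{1..2*n} \<subseteq> ?M ` {1..2*n}"
  proof
    fix k assume k: "k \<in> {1..2*n}"
    show "k \<in> ?M ` {1..2*n}"
    proof (cases "even k")
      case True
      then obtain j where j: "k = 2 * j" by blast
      with k have "j \<in> inv (block_perm \<pi>) ` {1..n}" unfolding permutes_image[OF P] by auto
      then obtain i where "i \<in> {1..n}" "j = inv (block_perm \<pi>) i" by blast
      then show ?thesis
        using j meandric_system_odd[of i n \<pi> \<rho>] by (intro image_eqI[of _ _ "2 * i - 1"]) auto
    next
      case False
      then obtain j where j: "k = 2 * j + 1" using oddE by blast
      with k have "j + 1 \<in> block_perm \<rho> ` {1..n}" unfolding permutes_image[OF Q] by auto
      then obtain i where "i \<in> {1..n}" "j + 1 = block_perm \<rho> i" by blast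
      then show ?thesis
        using j meandric_system_even[of i n \<pi> \<rho>] by (intro image_eqI[of _ _ "2 * i"]) auto
    qed
  qed
  then have "?M ` {1..2*n} = {1..2*n}"
    by (metis card_image_le card_seteq finite_atLeastAtMost finite_imageI)
  then show "bij_betw ?M {1..2*n} {1..2*n}"
    by (simp add: bij_betw_def eq_card_imp_inj_on)
  show "\<And>k. k \<notin> {1..2*n} \<Longrightarrow> ?M k = k"
    unfolding meandric_system_def by auto
qed

end

(*
  Since M exchanges odd and even numbers, an invariant interval has even length, so it is either
  {2i-1, ..., 2j} or {2i, ..., 2j-1}.  The first kind is invariant iff {i, ..., j} is a union of
  blocks of both partitions; a proper interval of this kind exists iff the join is not 1, because
  every non-crossing partition has a block which is an interval.  The second kind is invariant iff
  both P_pi and P_rho map {i, ..., j-1} onto {i+1, ..., j}, which happens iff i and j share a block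
  in both partitions, i.e. iff they share a block of the meet.
*)
theory Submission
  imports Defs
begin

section \<open>Blocks of non-crossing partitions, and the existence of an interval block\<close>

lemma NC_partition_on: "\<pi> \<in> NC n \<Longrightarrow> partition_on {1..n} \<pi>"
  by (simp add: NC_def)

lemma NC_noncrossing:
  assumes "\<pi> \<in> NC n" "V \<in> \<pi>" "W \<in> \<pi>" "a \<in> V" "c \<in> V" "b \<in> W" "d \<in> W" "a < b" "b < c" "c < d"
  shows "V = W"
proof -
  have "noncrossing \<pi>" using assms(1) by (simp add: NC_def)
  with assms(2-) show ?thesis unfolding noncrossing_def by metis
qed

lemma NC_Union: "\<pi> \<in> NC n \<Longrightarrow> \<Union>\<pi> = {1..n}"
  using partition_onD1[OF NC_partition_on] by simp

lemma NC_obtain_block: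
  assumes "\<pi> \<in> NC n" "i \<in> {1..n}"
  obtains V where "V \<in> \<pi>" "i \<in> V"
  using assms(2) unfolding NC_Union[OF assms(1), symmetric] by blast

lemma NC_block_subset: "\<pi> \<in> NC n \<Longrightarrow> V \<in> \<pi> \<Longrightarrow> V \<subseteq> {1..n}"
  using Union_upper NC_Union by metis

lemma NC_block_finite: "\<pi> \<in> NC n \<Longrightarrow> V \<in> \<pi> \<Longrightarrow> finite V"
  using finite_subset[OF NC_block_subset] by simp

lemma NC_block_nonempty: "\<pi> \<in> NC n \<Longrightarrow> V \<in> \<pi> \<Longrightarrow> V \<noteq> {}"
  using partition_onD3[OF NC_partition_on] by metis

lemma NC_blocks_eq: "\<pi> \<in> NC n \<Longrightarrow> V \<in> \<pi> \<Longrightarrow> W \<in> \<pi> \<Longrightarrow> i \<in> V \<Longrightarrow> i \<in> W \<Longrightarrow> V = W"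
  using disjointD[OF partition_onD2[OF NC_partition_on]] by (metis IntI empty_iff)

lemma NC_eq_NC_one:
  assumes "n \<ge> 1" "\<sigma> \<in> NC n" "{1..n} \<in> \<sigma>"
  shows "\<sigma> = NC_one n"
proof -
  have "V = {1..n}" if V: "V \<in> \<sigma>" for V
  proof -
    obtain i where "i \<in> V" using NC_block_nonempty[OF assms(2) V] by blast
    with NC_block_subset[OF assms(2) V] NC_blocks_eq[OF assms(2) V assms(3)] show ?thesis by blast
  qed
  with assms(3) show ?thesis unfolding NC_one_def by blast
qed

text \<open>Choose a block \<open>V\<close> that minimises \<open>Max V - Min V\<close>. A point
  missing between its extremes would lie in another block, which cannot cross \<open>V\<close> and
  is therefore nested strictly between these extremes; its spread would be smaller.\<close>

lemma NC_exists_interval_block: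
  assumes "n \<ge> 1" "\<sigma> \<in> NC n"
  obtains i j where "1 \<le> i" "i \<le> j" "j \<le> n" "{i..j} \<in> \<sigma>"
proof -
  obtain V0 where "V0 \<in> \<sigma>" using NC_obtain_block[OF assms(2), of 1] assms(1) by auto
  then obtain V where V: "V \<in> \<sigma>" and least: "\<And>W. W \<in> \<sigma> \<Longrightarrow> Max V - Min V \<le> Max W - Min W"
    using ex_has_least_nat[of "\<lambda>V. V \<in> \<sigma>" V0 "\<lambda>V. Max V - Min V"] by blast
  note finV = NC_block_finite[OF assms(2) V] and neV = NC_block_nonempty[OF assms(2) V]
  have "x \<in> V" if x: "Min V \<le> x" "x \<le> Max V" for x
  proof (rule ccontr)
    assume "x \<notin> V"
    have mem: "Min V \<in> V" "Max V \<in> V" using finV neV by auto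
    with \<open>x \<notin> V\<close> x have lt: "Min V < x" "x < Max V" by (metis le_neq_implies_less)+
    have "x \<in> {1..n}"
      using x subsetD[OF NC_block_subset[OF assms(2) V] mem(1)]
        subsetD[OF NC_block_subset[OF assms(2) V] mem(2)] by simp
    then obtain W where W: "W \<in> \<sigma>" "x \<in> W" using NC_obtain_block[OF assms(2)] by blast
    note finW = NC_block_finite[OF assms(2) W(1)] and neW = NC_block_nonempty[OF assms(2) W(1)]
    have "V \<noteq> W" using W \<open>x \<notin> V\<close> by blast
    \<comment> \<open>An element \<open>y\<close> of \<open>W\<close> beyond one of the extremes,
      together with \<open>x\<close> in \<open>W\<close> between them, would alternate with
      \<open>Min V\<close> and \<open>Max V\<close>.\<close>
    have "Min V < y \<and> y < Max V" if y: "y \<in> W" for y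
    proof -
      have "y \<noteq> Min V" "y \<noteq> Max V" using NC_blocks_eq[OF assms(2) V W(1)] y mem \<open>V \<noteq> W\<close> by metis+
      moreover have "\<not> y < Min V"
        using NC_noncrossing[OF assms(2) W(1) V y W(2) mem] lt \<open>V \<noteq> W\<close> by blast
      moreover have "\<not> Max V < y"
        using NC_noncrossing[OF assms(2) V W(1) mem W(2) y] lt \<open>V \<noteq> W\<close> by blast
      ultimately show ?thesis by linarith
    qed
    then have "Min V < Min W" "Max W < Max V" "Min W \<le> Max W"
      using finW neW by auto
    with least[OF W(1)] show False by linarith
  qed
  then have "{Min V..Max V} \<subseteq> V" by auto
  moreover have "V \<subseteq> {Min V..Max V}" using finV by auto
  ultimately have "V = {Min V..Max V}" by (rule subset_antisym[rotated])
  moreover have "Min V \<in> {1..n}" "Max V \<in> {1..n}" "Min V \<le> Max V"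
    using subsetD[OF NC_block_subset[OF assms(2) V] Min_in[OF finV neV]]
      subsetD[OF NC_block_subset[OF assms(2) V] Max_in[OF finV neV]] finV neV by simp_all
  ultimately show thesis using that[of "Min V" "Max V"] V by simp
qed

section \<open>Action of \<open>block_perm\<close> on unions of blocks and on intervals\<close>

lemma block_perm_nth:
  assumes "\<pi> \<in> NC n" "V \<in> \<pi>" "k < card V"
  shows "block_perm \<pi> (sorted_list_of_set V ! k) = sorted_list_of_set V ! (Suc k mod card V)"
proof -
  let ?xs = "sorted_list_of_set V"
  have "block_perm \<pi> (?xs ! k) = map (block_perm \<pi>) ?xs ! k" using assms(3) by simp
  also have "\<dots> = rotate1 ?xs ! k"
    using map_block_perm[OF NC_partition_on[OF assms(1)] finite_atLeastAtMost assms(2)] by simp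
  also have "\<dots> = ?xs ! (Suc k mod card V)" using assms(3) by (simp add: nth_rotate1)
  finally show ?thesis .
qed

text \<open>A larger element \<open>y\<close> in the same block means that \<open>x\<close> is not
  the last one, so the cycle does not wrap around at \<open>x\<close> and \<open>block_perm\<close>
  gives its successor in \<open>V\<close>.\<close>

lemma block_perm_less_le:
  assumes "\<pi> \<in> NC n" "V \<in> \<pi>" "x \<in> V" "y \<in> V" "x < y"
  shows "x < block_perm \<pi> x" "block_perm \<pi> x \<le> y"
proof -
  let ?xs = "sorted_list_of_set V"
  note fin = NC_block_finite[OF assms(1,2)]
  have "x \<in> set ?xs" "y \<in> set ?xs" using assms(3,4) fin by simp_all
  then obtain k l where kl: "k < card V" "?xs ! k = x" "l < card V" "?xs ! l = y"
    unfolding in_set_conv_nth by auto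
  have "k < l"
    using kl assms(5) sorted_nth_mono[of ?xs l k] by (cases "k < l") simp_all
  \<comment> \<open>Since \<open>Suc k \<le> l < card V\<close>, reduction modulo
    \<open>card V\<close> has no effect.\<close>
  with kl block_perm_nth[OF assms(1,2) kl(1)] have eq: "block_perm \<pi> x = ?xs ! Suc k" by simp
  show "block_perm \<pi> x \<le> y"
    unfolding eq using sorted_nth_mono[of ?xs "Suc k" l] kl \<open>k < l\<close> by simp
  show "x < block_perm \<pi> x"
    unfolding eq using sorted_wrt_nth_less[OF strict_sorted_list_of_set[of V], of k "Suc k"] kl \<open>k < l\<close>
    by simp
qed

text \<open>The blocks are the orbits of \<open>block_perm \<pi>\<close>: iterating from one point
  of a block reaches the whole block, so the invariant sets are the unions of blocks.\<close>

lemma block_perm_invariant_iff: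
  assumes "\<pi> \<in> NC n" "U \<subseteq> {1..n}"
  shows "block_perm \<pi> ` U = U \<longleftrightarrow> (\<forall>V\<in>\<pi>. V \<inter> U \<noteq> {} \<longrightarrow> V \<subseteq> U)"
proof
  assume inv: "block_perm \<pi> ` U = U"
  show "\<forall>V\<in>\<pi>. V \<inter> U \<noteq> {} \<longrightarrow> V \<subseteq> U"
  proof (intro ballI impI subsetI)
    fix V y assume V: "V \<in> \<pi>" "V \<inter> U \<noteq> {}" and y: "y \<in> V"
    let ?xs = "sorted_list_of_set V"
    note fin = NC_block_finite[OF assms(1) V(1)]
    obtain x where "x \<in> V" "x \<in> U" using V(2) by blast
    with y fin have "x \<in> set ?xs" "y \<in> set ?xs" by simp_all
    with \<open>x \<in> U\<close> obtain k l where kl: "k < card V" "?xs ! k \<in> U" "l < card V" "?xs ! l = y"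
      unfolding in_set_conv_nth by auto
    have "?xs ! ((k + m) mod card V) \<in> U" for m
    proof (induction m)
      case (Suc m)
      have "(k + m) mod card V < card V" using kl by simp
      from block_perm_nth[OF assms(1) V(1) this]
      have "?xs ! ((k + Suc m) mod card V) = block_perm \<pi> (?xs ! ((k + m) mod card V))"
        by (simp add: mod_Suc_eq)
      with Suc inv show ?case by auto
    qed (use kl in simp)
    \<comment> \<open>This number of iterations leads from index \<open>k\<close> to
      \<open>l + card V\<close>, which is \<open>l\<close> modulo \<open>card V\<close>. The extra
      \<open>card V\<close> keeps the subtraction from truncating when \<open>l < k\<close>.\<close>
    from this[of "l + card V - k"] kl show "y \<in> U" by simp
  qed
next
  assume blocks: "\<forall>V\<in>\<pi>. V \<inter> U \<noteq> {} \<longrightarrow> V \<subseteq> U"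
  let ?B = "{V \<in> \<pi>. V \<inter> U \<noteq> {}}"
  have "U \<subseteq> \<Union>\<pi>" using assms(2) by (simp add: NC_Union[OF assms(1)])
  with blocks have "U = \<Union>?B" by blast
  moreover have "block_perm \<pi> ` \<Union>?B = \<Union>?B"
    using block_perm_image[OF NC_partition_on[OF assms(1)]] by (simp add: image_Union)
  ultimately show "block_perm \<pi> ` U = U" by simp
qed

text \<open>Forwards this is a count. If \<open>V\<close> is the block of \<open>i\<close>, the
  permutation maps \<open>V \<inter> {i..<j}\<close> onto \<open>V \<inter> {Suc i..j}\<close>; the
  first set contains \<open>i\<close>, and only \<open>j\<close> can make up for its loss in the
  second. Backwards, a common block of \<open>i\<close> and \<open>j\<close> confines all other
  blocks that meet the interval, because they may not cross it.\<close>

lemma block_perm_shift_iff: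
  assumes "\<pi> \<in> NC n" "1 \<le> i" "i < j" "j \<le> n"
  shows "block_perm \<pi> ` {i..<j} = {Suc i..j} \<longleftrightarrow> (\<exists>V\<in>\<pi>. i \<in> V \<and> j \<in> V)"
proof
  let ?P = "block_perm \<pi>"
  have inj: "inj ?P" using block_perm_permutes[OF assms(1)] by (rule permutes_inj)
  {
    assume shift: "?P ` {i..<j} = {Suc i..j}"
    obtain V where V: "V \<in> \<pi>" "i \<in> V" using NC_obtain_block[OF assms(1), of i] assms by auto
    have "?P ` V = V" using block_perm_image[OF NC_partition_on[OF assms(1)] _ V(1)] by simp
    then have "?P ` (V \<inter> {i..<j}) = V \<inter> {Suc i..j}"
      using shift by (simp add: image_Int[OF inj])
    then have card: "card (V \<inter> {i..<j}) = card (V \<inter> {Suc i..j})"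
      using card_image[OF inj_on_subset[OF inj subset_UNIV]] by metis
    have "j \<in> V"
    proof (rule ccontr)
      assume "j \<notin> V"
      then have "V \<inter> {Suc i..j} \<subseteq> V \<inter> {i..<j}" by (auto simp: less_le)
      moreover have "i \<in> V \<inter> {i..<j}" "i \<notin> V \<inter> {Suc i..j}" using V(2) assms(3) by auto
      ultimately have "V \<inter> {Suc i..j} \<subset> V \<inter> {i..<j}" by blast
      then have "card (V \<inter> {Suc i..j}) < card (V \<inter> {i..<j})" by (intro psubset_card_mono) simp_all
      with card show False by simp
    qed
    with V show "\<exists>V\<in>\<pi>. i \<in> V \<and> j \<in> V" by blast
  }
  assume "\<exists>V\<in>\<pi>. i \<in> V \<and> j \<in> V"
  then obtain V where V: "V \<in> \<pi>" "i \<in> V" "j \<in> V" by blast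
  have "?P ` {i..<j} \<subseteq> {Suc i..j}"
  proof (rule image_subsetI)
    fix x assume x: "x \<in> {i..<j}"
    obtain W where W: "W \<in> \<pi>" "x \<in> W" using NC_obtain_block[OF assms(1), of x] assms x by auto
    show "?P x \<in> {Suc i..j}"
    proof (cases "V = W")
      case True
      with block_perm_less_le[OF assms(1) V(1) _ V(3), of x] W x show ?thesis by auto
    next
      case False
      have mem: "?P x \<in> W"
        using block_perm_image[OF NC_partition_on[OF assms(1)] _ W(1)] W(2) by auto
      \<comment> \<open>Both endpoints lie in \<open>V\<close>, so \<open>W\<close> avoids them.
        This makes the inequalities below strict, as a crossing requires.\<close>
      have ne: "y \<noteq> i" "y \<noteq> j" if "y \<in> W" for y
        using NC_blocks_eq[OF assms(1) V(1) W(1)] V that False by metis+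
      have "\<not> ?P x < i"
        using NC_noncrossing[OF assms(1) W(1) V(1) mem W(2) V(2,3)] False ne[OF W(2)] x by auto
      moreover have "\<not> j < ?P x"
        using NC_noncrossing[OF assms(1) V(1) W(1) V(2,3) W(2) mem] False ne[OF W(2)] x by auto
      ultimately show ?thesis using ne[OF mem] by simp
    qed
  qed
  \<comment> \<open>Both sets have \<open>j - i\<close> elements, which turns the inclusion into
    equality.\<close>
  moreover have "card (?P ` {i..<j}) = card {Suc i..j}"
    using card_image[OF inj_on_subset[OF inj subset_UNIV]] by simp
  ultimately show "?P ` {i..<j} = {Suc i..j}" by (simp add: card_subset_eq)
qed

section \<open>Invariant sets of the meandric system\<close>

text \<open>\<open>L\<close> and \<open>K\<close> index the even and the odd members of
  \<open>S\<close>. The system sends even members to odd ones through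
  \<open>block_perm \<rho>\<close> and odd members to even ones through the inverse of
  \<open>block_perm \<pi>\<close>, so invariance splits into one condition for each
  partition.\<close>

lemma meandric_system_invariant_iff:
  assumes "\<pi> \<in> NC n" "\<rho> \<in> NC n" "S \<subseteq> {1..2*n}"
  defines "L \<equiv> {k. 2 * k \<in> S}" and "K \<equiv> {k. 2 * k - 1 \<in> S}"
  shows "meandric_system n \<pi> \<rho> ` S = S \<longleftrightarrow> block_perm \<pi> ` L = K \<and> block_perm \<rho> ` L = K"
proof -
  let ?M = "meandric_system n \<pi> \<rho>" and ?P = "block_perm \<pi>" and ?Q = "block_perm \<rho>"
  let ?e = "\<lambda>k::nat. 2 * k" and ?o = "\<lambda>k::nat. 2 * k - 1"
  have bij: "bij ?P" using block_perm_permutes[OF assms(1)] by (rule permutes_bij)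
  \<comment> \<open>Index 0 gives 0 under both encodings, since \<open>2 * 0 - 1 = 0\<close> in the
    naturals; it is excluded because 0 is not in \<open>S\<close>.\<close>
  have sub: "L \<subseteq> {1..n}" "K \<subseteq> {1..n}"
    by (auto simp: L_def K_def dest!: subsetD[OF assms(3)])
  have inv_sub: "inv ?P ` K \<subseteq> {1..n}" and Q_sub: "?Q ` L \<subseteq> {1..n}"
    using permutes_image[OF permutes_inv[OF block_perm_permutes[OF assms(1)]]]
      permutes_image[OF block_perm_permutes[OF assms(2)]] sub by blast+
  have S: "S = ?o ` K \<union> ?e ` L"
  proof (intro equalityI subsetI)
    fix k assume k: "k \<in> S"
    show "k \<in> ?o ` K \<union> ?e ` L"
    proof (cases "even k")
      case True
      then obtain l where "k = 2 * l" by blast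
      with k show ?thesis by (auto simp: L_def)
    next
      case False
      then obtain l where "k = 2 * l + 1" by (rule oddE)
      then have "k = 2 * Suc l - 1" by simp
      with k show ?thesis unfolding K_def by blast
    qed
  qed (auto simp: L_def K_def)
  have "?M ` ?o ` K = ?e ` inv ?P ` K"
    unfolding image_image using sub(2) by (intro image_cong refl meandric_system_odd) auto
  moreover have "?M ` ?e ` L = ?o ` ?Q ` L"
    unfolding image_image using sub(1) by (intro image_cong refl meandric_system_even) auto
  ultimately have M: "?M ` S = ?o ` ?Q ` L \<union> ?e ` inv ?P ` K"
    unfolding S by (simp add: image_Un Un_commute)
  \<comment> \<open>A union of odd and even numbers determines its two index sets. The bounds on
    \<open>A\<close> and \<open>A'\<close> exclude index 0, whose image \<open>2 * 0 - 1\<close>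
    would be even.\<close>
  have parity: "A = A' \<and> B = B'"
    if eq: "?o ` A \<union> ?e ` B = ?o ` A' \<union> ?e ` B'"
      and sub': "A \<subseteq> {1..n}" "A' \<subseteq> {1..n}" for A A' B B'
  proof -
    have e: "B = {k. 2 * k \<in> ?o ` A \<union> ?e ` B}" if A: "A \<subseteq> {1..n}" for A B
    proof -
      have "2 * k \<noteq> 2 * l - 1" if "l \<in> A" for k l
      proof -
        have "1 \<le> l" using that A by auto
        then show ?thesis by presburger
      qed
      then show ?thesis by (auto simp: image_iff)
    qed
    have o: "A = {k. 1 \<le> k \<and> 2 * k - 1 \<in> ?o ` A \<union> ?e ` B}" if A: "A \<subseteq> {1..n}" for A B
    proof -
      have "k = l" if "l \<in> A" "1 \<le> k" "2 * k - 1 = 2 * l - 1" for k l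
      proof -
        have "1 \<le> l" using that(1) A by auto
        with that show ?thesis by linarith
      qed
      moreover have "2 * k - 1 \<noteq> 2 * l" if "1 \<le> k" for k l :: nat
        using that by presburger
      ultimately show ?thesis using A by (auto simp: image_iff)
    qed
    show ?thesis
      using e[OF sub'(1), of B] e[OF sub'(2), of B'] o[OF sub'(1), of B] o[OF sub'(2), of B']
      unfolding eq by simp
  qed
  have "?M ` S = S \<longleftrightarrow> ?Q ` L = K \<and> inv ?P ` K = L"
    using parity[OF _ Q_sub sub(2)] M S by metis
  \<comment> \<open>Inverting the bijection puts the condition on \<pi> into the same form as that
    on \<rho>.\<close>
  also have "inv ?P ` K = L \<longleftrightarrow> ?P ` L = K"
    using bij by (metis bij_is_inj bij_is_surj image_f_inv_f image_inv_f_f)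
  finally show ?thesis by blast
qed

text \<open>The two alternatives belong to invariant intervals that start at an odd and at an even
  number. In the second, \<open>i < j\<close> says that the interval is non-empty, and it is
  automatically proper because it omits 1.\<close>

lemma meandric_reducible_iff:
  assumes "\<pi> \<in> NC n" "\<rho> \<in> NC n"
  shows "meandric_reducible n \<pi> \<rho> \<longleftrightarrow>
    (\<exists>i j. 1 \<le> i \<and> i \<le> j \<and> j \<le> n \<and> {i..j} \<noteq> {1..n} \<and>
       block_perm \<pi> ` {i..j} = {i..j} \<and> block_perm \<rho> ` {i..j} = {i..j}) \<or>
    (\<exists>i j. 1 \<le> i \<and> i < j \<and> j \<le> n \<and>
       block_perm \<pi> ` {i..<j} = {Suc i..j} \<and> block_perm \<rho> ` {i..<j} = {Suc i..j})"
    (is "_ \<longleftrightarrow> ?A \<or> ?B")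
proof -
  note inv = meandric_system_invariant_iff[OF assms]
  have closed: "{k. 2 * k \<in> {2 * i - 1..2 * j}} = {i..j}" "{k. 2 * k - 1 \<in> {2 * i - 1..2 * j}} = {i..j}"
    if "1 \<le> i" for i j :: nat
    using that by auto
  \<comment> \<open>In an interval starting at an even number, the odd members have indices one
    higher than the even ones; this is the shift by one in \<open>?B\<close>.\<close>
  have half_open: "{k. 2 * k \<in> {2 * i..2 * j - 1}} = {i..<j}" "{k. 2 * k - 1 \<in> {2 * i..2 * j - 1}} = {Suc i..j}"
    if "1 \<le> i" for i j :: nat
    using that by auto
  show ?thesis
  proof
    assume "meandric_reducible n \<pi> \<rho>"
    then obtain a b where ab: "1 \<le> a" "a \<le> b" "b \<le> 2 * n" "b - a < 2 * n - 1"
      and M: "meandric_system n \<pi> \<rho> ` {a..b} = {a..b}"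
      unfolding meandric_reducible_def by blast
    let ?L = "{k. 2 * k \<in> {a..b}}" and ?K = "{k. 2 * k - 1 \<in> {a..b}}"
    have LK: "block_perm \<pi> ` ?L = ?K" "block_perm \<rho> ` ?L = ?K"
      using inv[of "{a..b}"] M ab by auto
    have "inj (block_perm \<pi>)" using block_perm_permutes[OF assms(1)] by (rule permutes_inj)
    then have card: "card ?L = card ?K"
      using LK(1) card_image[OF inj_on_subset[OF _ subset_UNIV]] by metis
    have L: "?L = {(a + 1) div 2..b div 2}" by auto
    have K: "?K = {a div 2 + 1..(b + 1) div 2}" using ab(1) by auto
    \<comment> \<open>The two sides count the even and the odd numbers in \<open>{a..b}\<close>.
      They agree only if \<open>a\<close> and \<open>b\<close> have opposite parity.\<close>
    from card have cards: "b div 2 + 1 - (a + 1) div 2 = (b + 1) div 2 - a div 2"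
      unfolding L K by simp
    show "?A \<or> ?B"
    proof (cases "even a")
      case True
      then obtain i where i: "a = 2 * i" by blast
      have "odd b"
      proof
        assume "even b"
        then obtain j where "b = 2 * j" by blast
        with cards ab(2) i show False by simp
      qed
      define j where "j = Suc (b div 2)"
      with \<open>odd b\<close> have j: "b = 2 * j - 1" by (auto elim!: oddE)
      from ab i j have "1 \<le> i" "i < j" "j \<le> n" by linarith+
      with LK[unfolded i j half_open[OF \<open>1 \<le> i\<close>]] show ?thesis by blast
    next
      case False
      define i where "i = Suc (a div 2)"
      with False have i: "a = 2 * i - 1" "1 \<le> i" by (auto elim!: oddE)
      have "even b"
      proof (rule ccontr)
        assume "odd b"
        then obtain j where "b = 2 * j + 1" by (rule oddE)
        with cards ab(2) i show False by auto
      qed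
      then obtain j where j: "b = 2 * j" by blast
      from ab i j have "i \<le> j" "j \<le> n" by linarith+
      moreover have "{i..j} \<noteq> {1..n}"
      proof
        assume "{i..j} = {1..n}"
        with i(2) \<open>i \<le> j\<close> have "i = 1" "j = n" by (simp_all add: Icc_eq_Icc)
        with ab i j show False by simp
      qed
      ultimately show ?thesis using LK[unfolded i(1) j closed[OF i(2)]] i(2) by blast
    qed
  next
    assume "?A \<or> ?B"
    then show "meandric_reducible n \<pi> \<rho>"
    proof
      assume ?A
      then obtain i j where ij: "1 \<le> i" "i \<le> j" "j \<le> n" "{i..j} \<noteq> {1..n}"
        "block_perm \<pi> ` {i..j} = {i..j}" "block_perm \<rho> ` {i..j} = {i..j}" by blast
      then have "i \<noteq> 1 \<or> j \<noteq> n" by auto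
      then have "2 * j - (2 * i - 1) < 2 * n - 1" using ij(1-3) by linarith
      moreover
      have "meandric_system n \<pi> \<rho> ` {2 * i - 1..2 * j} = {2 * i - 1..2 * j}"
      proof -
        have sub: "{2 * i - 1..2 * j} \<subseteq> {1..2 * n}" using ij(1-3) by auto
        show ?thesis using inv[OF sub] ij(5,6) unfolding closed[OF ij(1)] by blast
      qed
      ultimately show ?thesis
        unfolding meandric_reducible_def using ij(1-3)
        by (intro exI[of _ "2 * i - 1"] exI[of _ "2 * j"] conjI) linarith+
    next
      assume ?B
      then obtain i j where ij: "1 \<le> i" "i < j" "j \<le> n"
        "block_perm \<pi> ` {i..<j} = {Suc i..j}" "block_perm \<rho> ` {i..<j} = {Suc i..j}" by blast
      have sub: "{2 * i..2 * j - 1} \<subseteq> {1..2 * n}" using ij(1-3) by auto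
      have "meandric_system n \<pi> \<rho> ` {2 * i..2 * j - 1} = {2 * i..2 * j - 1}"
        using inv[OF sub] ij(4,5) unfolding half_open[OF ij(1)] by blast
      then show ?thesis
        unfolding meandric_reducible_def using ij(1-3)
        by (intro exI[of _ "2 * i"] exI[of _ "2 * j - 1"] conjI) linarith+
    qed
  qed
qed

section \<open>Join and meet in terms of intervals and pairs of points\<close>

text \<open>This partition serves as a common upper bound different from \<open>NC_one n\<close>. In
  a crossing, one of the two middle points would be a point of the complement lying between two
  points of the interval.\<close>

lemma NC_interval_and_complement:
  assumes "1 \<le> i" "i \<le> j" "j \<le> n" "{i..j} \<noteq> {1..n}"
  shows "{{i..j}, {1..n} - {i..j}} \<in> NC n"
proof -
  have "partition_on {1..n} {{i..j}, {1..n} - {i..j}}"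
    using assms by (auto simp: partition_on_def disjoint_def)
  moreover have "noncrossing {{i..j}, {1..n} - {i..j}}"
    unfolding noncrossing_def by auto
  ultimately show ?thesis by (simp add: NC_def)
qed

text \<open>A proper interval invariant under both permutations gives a two-block upper bound, and
  the join lies below it. Conversely, an interval block of the join is a union of blocks of both
  partitions, hence invariant; if only the full interval is allowed, this block is
  everything.\<close>

lemma NC_join_eq_one_iff:
  assumes "n \<ge> 1" "\<pi> \<in> NC n" "\<rho> \<in> NC n"
  shows "\<pi> \<squnion>\<^bsub>NC_lattice n\<^esub> \<rho> = NC_one n \<longleftrightarrow>
    \<not> (\<exists>i j. 1 \<le> i \<and> i \<le> j \<and> j \<le> n \<and> {i..j} \<noteq> {1..n} \<and>
       block_perm \<pi> ` {i..j} = {i..j} \<and> block_perm \<rho> ` {i..j} = {i..j})"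
proof -
  interpret lattice "NC_lattice n" by (rule lattice_NC_lattice[OF assms(1)])
  define \<sigma> where "\<sigma> = \<pi> \<squnion>\<^bsub>NC_lattice n\<^esub> \<rho>"
  have carr: "\<pi> \<in> carrier (NC_lattice n)" "\<rho> \<in> carrier (NC_lattice n)"
    using assms by (simp_all add: NC_lattice_def)
  have \<sigma>: "\<sigma> \<in> NC n" "refines {1..n} \<pi> \<sigma>" "refines {1..n} \<rho> \<sigma>"
    using join_closed[OF carr] join_left[OF carr] join_right[OF carr]
    by (simp_all add: \<sigma>_def NC_lattice_def)
  have least: "refines {1..n} \<sigma> \<tau>"
    if "\<tau> \<in> NC n" "refines {1..n} \<pi> \<tau>" "refines {1..n} \<rho> \<tau>" for \<tau>
    using join_le[of \<pi> \<tau> \<rho>] that carr by (simp add: \<sigma>_def NC_lattice_def)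
  show ?thesis
    unfolding \<sigma>_def[symmetric]
  proof
    assume one: "\<sigma> = NC_one n"
    show "\<not> (\<exists>i j. 1 \<le> i \<and> i \<le> j \<and> j \<le> n \<and> {i..j} \<noteq> {1..n} \<and>
       block_perm \<pi> ` {i..j} = {i..j} \<and> block_perm \<rho> ` {i..j} = {i..j})"
    proof (intro notI, elim exE conjE)
      fix i j assume ij: "1 \<le> i" "i \<le> j" "j \<le> n" "{i..j} \<noteq> {1..n}"
        and inv: "block_perm \<pi> ` {i..j} = {i..j}" "block_perm \<rho> ` {i..j} = {i..j}"
      let ?\<tau> = "{{i..j}, {1..n} - {i..j}}"
      note \<tau> = NC_interval_and_complement[OF ij]
      \<comment> \<open>Stated for a generic \<kappa> so that it applies to both \<pi> and
        \<rho>.\<close>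
      have ref: "refines {1..n} \<kappa> ?\<tau>" if \<kappa>: "\<kappa> \<in> NC n" "block_perm \<kappa> ` {i..j} = {i..j}" for \<kappa>
      proof -
        have "\<forall>V\<in>\<kappa>. V \<inter> {i..j} \<noteq> {} \<longrightarrow> V \<subseteq> {i..j}"
          using block_perm_invariant_iff[OF \<kappa>(1), of "{i..j}"] \<kappa>(2) ij by auto
        then have "\<forall>V\<in>\<kappa>. V \<subseteq> {i..j} \<or> V \<subseteq> {1..n} - {i..j}"
          using NC_block_subset[OF \<kappa>(1)] by blast
        then show ?thesis
          using NC_partition_on[OF \<tau>] NC_partition_on[OF \<kappa>(1)] by (simp add: refines_def)
      qed
      have "refines {1..n} (NC_one n) ?\<tau>"
        using least[OF \<tau>] ref assms inv one by metis
      then have "{1..n} \<subseteq> {i..j} \<or> {1..n} \<subseteq> {1..n} - {i..j}"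
        by (simp add: refines_def NC_one_def)
      moreover have "i \<in> {1..n}" "i \<in> {i..j}" "{i..j} \<subseteq> {1..n}" using ij by auto
      ultimately show False using ij(4) by blast
    qed
  next
    assume none: "\<not> (\<exists>i j. 1 \<le> i \<and> i \<le> j \<and> j \<le> n \<and> {i..j} \<noteq> {1..n} \<and>
       block_perm \<pi> ` {i..j} = {i..j} \<and> block_perm \<rho> ` {i..j} = {i..j})"
    obtain i j where ij: "1 \<le> i" "i \<le> j" "j \<le> n" "{i..j} \<in> \<sigma>"
      using NC_exists_interval_block[OF assms(1) \<sigma>(1)] by blast
    have "block_perm \<kappa> ` {i..j} = {i..j}" if \<kappa>: "\<kappa> \<in> NC n" "refines {1..n} \<kappa> \<sigma>" for \<kappa>
    proof -
      have "V \<subseteq> {i..j}" if V: "V \<in> \<kappa>" "V \<inter> {i..j} \<noteq> {}" for V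
      proof -
        obtain Y where "Y \<in> \<sigma>" "V \<subseteq> Y" using \<kappa>(2) V(1) unfolding refines_def by blast
        with V(2) NC_blocks_eq[OF \<sigma>(1) _ ij(4)] show ?thesis by blast
      qed
      with block_perm_invariant_iff[OF \<kappa>(1), of "{i..j}"] ij show ?thesis by auto
    qed
    with none ij assms \<sigma> have "{i..j} = {1..n}" by blast
    with ij NC_eq_NC_one[OF assms(1) \<sigma>(1)] show "\<sigma> = NC_one n" by simp
  qed
qed

text \<open>The blocks of the meet are the non-empty intersections of blocks, so the meet is
  \<open>NC_zero n\<close> exactly when no such intersection has two points; \<open>i < j\<close>
  merely orders these points.\<close>

lemma NC_meet_eq_zero_iff:
  assumes "n \<ge> 1" "\<pi> \<in> NC n" "\<rho> \<in> NC n"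
  shows "\<pi> \<sqinter>\<^bsub>NC_lattice n\<^esub> \<rho> = NC_zero n \<longleftrightarrow>
    \<not> (\<exists>i j. 1 \<le> i \<and> i < j \<and> j \<le> n \<and>
       (\<exists>V\<in>\<pi>. i \<in> V \<and> j \<in> V) \<and> (\<exists>W\<in>\<rho>. i \<in> W \<and> j \<in> W))"
proof -
  let ?m = "{V \<inter> W | V W. V \<in> \<pi> \<and> W \<in> \<rho> \<and> V \<inter> W \<noteq> {}}"
  have "?m = NC_zero n \<longleftrightarrow> \<not> (\<exists>i j. 1 \<le> i \<and> i < j \<and> j \<le> n \<and>
       (\<exists>V\<in>\<pi>. i \<in> V \<and> j \<in> V) \<and> (\<exists>W\<in>\<rho>. i \<in> W \<and> j \<in> W))" (is "_ \<longleftrightarrow> \<not> ?E")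
  proof
    assume eq: "?m = NC_zero n"
    show "\<not> ?E"
    proof (intro notI, elim exE conjE bexE)
      fix i j V W
      assume "i < j" "V \<in> \<pi>" "i \<in> V" "j \<in> V" "W \<in> \<rho>" "i \<in> W" "j \<in> W"
      moreover from this have "V \<inter> W \<in> NC_zero n" unfolding eq[symmetric] by blast
      then obtain k where "V \<inter> W = {k}" unfolding NC_zero_def by blast
      ultimately show False by (metis IntI less_irrefl singletonD)
    qed
  next
    assume none: "\<not> ?E"
    have single: "V \<inter> W = {i}" if "V \<in> \<pi>" "W \<in> \<rho>" "i \<in> V" "i \<in> W" for V W i
    proof -
      have "k = i" if k: "k \<in> V" "k \<in> W" for k
      proof (rule ccontr)
        assume "k \<noteq> i"
        moreover have "k \<in> {1..n}" "i \<in> {1..n}"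
          using NC_block_subset[OF assms(2) \<open>V \<in> \<pi>\<close>] k \<open>i \<in> V\<close> by blast+
        ultimately show False
          using none k \<open>V \<in> \<pi>\<close> \<open>W \<in> \<rho>\<close> \<open>i \<in> V\<close> \<open>i \<in> W\<close>
          by (metis atLeastAtMost_iff linorder_neqE_nat)
      qed
      with that show ?thesis by blast
    qed
    show "?m = NC_zero n"
    proof (intro equalityI subsetI)
      fix X assume "X \<in> ?m"
      then obtain V W i where VW: "X = V \<inter> W" "V \<in> \<pi>" "W \<in> \<rho>" "i \<in> V" "i \<in> W" by blast
      with single NC_block_subset[OF assms(2) VW(2)] show "X \<in> NC_zero n"
        unfolding NC_zero_def by blast
    next
      fix X assume "X \<in> NC_zero n"
      then obtain i where i: "X = {i}" "i \<in> {1..n}" unfolding NC_zero_def by blast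
      obtain V W where VW: "V \<in> \<pi>" "i \<in> V" "W \<in> \<rho>" "i \<in> W"
        using NC_obtain_block[OF assms(2) i(2)] NC_obtain_block[OF assms(3) i(2)] by metis
      then have "X = V \<inter> W" using single i(1) by simp
      with VW i(1) show "X \<in> ?m" by blast
    qed
  qed
  then show ?thesis using NC_meet_eq[OF assms] by simp
qed

section \<open>Equality of the two sets of pairs\<close>

theorem theorem1p1:
  fixes n :: nat
  assumes "n \<ge> 1"
  shows "m_irr n =
    card {(\<pi>, \<rho>) \<in> NC n \<times> NC n.
            \<pi> \<squnion>\<^bsub>NC_lattice n\<^esub> \<rho> = NC_one n \<and> \<pi> \<sqinter>\<^bsub>NC_lattice n\<^esub> \<rho> = NC_zero n}"
proof -
  have irr: "meandric_irreducible n \<pi> \<rho> \<longleftrightarrow>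
      \<pi> \<squnion>\<^bsub>NC_lattice n\<^esub> \<rho> = NC_one n \<and> \<pi> \<sqinter>\<^bsub>NC_lattice n\<^esub> \<rho> = NC_zero n"
    if NC: "\<pi> \<in> NC n" "\<rho> \<in> NC n" for \<pi> \<rho>
  proof -
    \<comment> \<open>With the shift condition replaced by common blocks, the two alternatives of
      reducibility become literally the negations of the join and the meet condition.\<close>
    have "1 \<le> i \<and> i < j \<and> j \<le> n \<and>
          block_perm \<pi> ` {i..<j} = {Suc i..j} \<and> block_perm \<rho> ` {i..<j} = {Suc i..j} \<longleftrightarrow>
        1 \<le> i \<and> i < j \<and> j \<le> n \<and>
          (\<exists>V\<in>\<pi>. i \<in> V \<and> j \<in> V) \<and> (\<exists>W\<in>\<rho>. i \<in> W \<and> j \<in> W)" for i j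
      by (intro conj_cong refl block_perm_shift_iff) (use NC in simp_all)
    then show ?thesis
      unfolding meandric_reducible_iff[OF NC] NC_join_eq_one_iff[OF assms NC]
        NC_meet_eq_zero_iff[OF assms NC] by simp
  qed
  have "{(\<pi>, \<rho>) \<in> NC n \<times> NC n. meandric_irreducible n \<pi> \<rho>} =
      {(\<pi>, \<rho>) \<in> NC n \<times> NC n.
        \<pi> \<squnion>\<^bsub>NC_lattice n\<^esub> \<rho> = NC_one n \<and> \<pi> \<sqinter>\<^bsub>NC_lattice n\<^esub> \<rho> = NC_zero n}"
    by (rule Collect_cong) (use irr in blast)
  then show ?thesis unfolding m_irr_def by (rule arg_cong)
qed

end
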